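(* 1. Let $u=\alpha X^n$ be a monic element of $B_n=K(H)X^n$ with $n\neq 0$. The centralizer $C(u,B)=K[v,v^{-1}]$ is a Laurent polynomial ring in a uniquely defined variable $v=\beta X^{\mathrm{sign}(n)s}$, where $s$ is the minimal positive divisor of $n$ for which there exists an element $\beta=\beta_s\in K(H)$, necessarily monic and uniquely defined, such that $$\beta\,\sigma^s(\beta)\,\sigma^{2s}(\beta)\cdots\sigma^{(n/s-1)s}(\beta)=\alpha\quad\text{if } n>0,$$ $$\beta\,\sigma^{-s}(\beta)\,\sigma^{-2s}(\beta)\cdots\sigma^{-(|n|/s-1)s}(\beta)=\alpha\quad\text{if } n<0.$$ 2. Let $u\in K(H)\setminus K$. Then $C(u,B)=K(H)$.
   Context: $K$ is a field of characteristic zero, $K(H)$ is the field of rational functions in one variable $H$, and $\sigma$ is the $K$-automorphism of $K(H)$ with $\sigma(H)=H-1$. $B=K(H)[X,X^{-1};\sigma]=\bigoplus_{i\in\mathbb{Z}}B_i$, $B_i=K(H)X^i$, is the skew Laurent polynomial ring with $X\alpha=\sigma(\alpha)X$ for $\alpha\in K(H)$; it is a $\mathbb{Z}$-graded algebra. A polynomial in $K[H]$ is monic if its leading coefficient is $1$; a rational function in $K(H)$ is monic if it equals $f/g$ for some monic polynomials $f,g$; a homogeneous element $\alpha X^n$ of $B$ is monic if $\alpha$ is a monic rational function. For $u\in B$, $C(u,B)=\{b\in B: ub=bu\}$ is the centralizer of $u$ in $B$. $\mathrm{sign}(n)$ and $|n|$ denote the sign and absolute value of $n\in\mathbb{Z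}$.
   Formalization: "Necessarily monic and uniquely defined" fails literally (alpha=1, n=2, s=1: beta=1 and beta=-1 both solve it); proved instead: a monic beta exists, is the only monic solution, and every solution is zeta*beta with zeta in K, zeta^(|n|/s)=1. *)

theory Defs
  imports
    "HOL-Computational_Algebra.Polynomial"
    "HOL-Computational_Algebra.Fraction_Field"
    "HOL-Library.Poly_Mapping"
begin

section \<open>The field \<open>K(H)\<close> and its automorphism \<open>\<sigma>\<close>\<close>

text \<open>\<open>K\<close> is the type \<open>'a\<close> of class \<open>field_char_0\<close>, and \<open>K(H)\<close> is the fraction field
  \<open>'a poly fract\<close>, where \<open>H\<close> is the polynomial \<open>[:0, 1:]\<close>.\<close>

definition ratfun_const :: "'a::field_char_0 \<Rightarrow> 'a poly fract" where
  "ratfun_const c = Fract [:c:] 1"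

definition monic_ratfun :: "'a::field_char_0 poly fract \<Rightarrow> bool" where
  "monic_ratfun r \<longleftrightarrow> (\<exists>f g. lead_coeff f = 1 \<and> lead_coeff g = 1 \<and> r = Fract f g)"

lemma pcompose_shift_eq_0_iff:
  "pcompose p [:c, 1:] = 0 \<longleftrightarrow> p = (0 :: 'a::field_char_0 poly)"
  by (rule pcompose_eq_0_iff) simp

lifting_forget poly.lifting

lift_definition sigma :: "'a::field_char_0 poly fract \<Rightarrow> 'a poly fract"
  is "\<lambda>(f, g). (pcompose f [:-1, 1:], pcompose g [:-1, 1:])"
  by (auto simp: pcompose_shift_eq_0_iff simp flip: pcompose_mult)

lift_definition sigma_inv :: "'a::field_char_0 poly fract \<Rightarrow> 'a poly fract"
  is "\<lambda>(f, g). (pcompose f [:1, 1:], pcompose g [:1, 1:])"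
  by (auto simp: pcompose_shift_eq_0_iff simp flip: pcompose_mult)

lemma sigma_Fract: "sigma (Fract f g) = Fract (pcompose f [:-1, 1:]) (pcompose g [:-1, 1:])"
  by transfer (simp add: pcompose_shift_eq_0_iff pcompose_1)

lemma sigma_inv_Fract: "sigma_inv (Fract f g) = Fract (pcompose f [:1, 1:]) (pcompose g [:1, 1:])"
  by transfer (simp add: pcompose_shift_eq_0_iff pcompose_1)

lemma sigma_H: "sigma (Fract [:0, 1:] 1) = Fract [:0, 1:] 1 - (1 :: 'a::field_char_0 poly fract)"
  by (simp add: sigma_Fract pcompose_pCons pcompose_1 One_fract_def) (simp only: one_pCons diff_pCons, simp)

lemma sigma_const: "sigma (ratfun_const c) = ratfun_const c"
  by (simp add: ratfun_const_def sigma_Fract pcompose_1)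

lemma sigma_0 [simp]: "sigma 0 = 0"
  by (simp add: Zero_fract_def sigma_Fract pcompose_1)

lemma sigma_1 [simp]: "sigma 1 = 1"
  by (simp add: One_fract_def sigma_Fract pcompose_1)

lemma sigma_add: "sigma (r + s) = sigma r + sigma s"
  by (cases r; cases s)
     (simp add: sigma_Fract pcompose_shift_eq_0_iff pcompose_mult pcompose_add)

lemma sigma_mult: "sigma (r * s) = sigma r * sigma s"
  by (cases r; cases s) (simp add: sigma_Fract pcompose_mult)

lemma sigma_sigma_inv [simp]: "sigma (sigma_inv r) = r"
  by (cases r) (simp add: sigma_Fract sigma_inv_Fract pcompose_pCons flip: pcompose_assoc)

lemma sigma_inv_sigma [simp]: "sigma_inv (sigma r) = r"
  by (cases r) (simp add: sigma_Fract sigma_inv_Fract pcompose_pCons flip: pcompose_assoc)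

lemma bij_sigma: "bij sigma"
  by (rule o_bij[of sigma_inv]) auto

lemma inv_sigma: "inv sigma = sigma_inv"
  by (rule inv_unique_comp) auto

definition sigma_pow :: "int \<Rightarrow> 'a::field_char_0 poly fract \<Rightarrow> 'a poly fract" where
  "sigma_pow i = (if i \<ge> 0 then sigma ^^ nat i else inv sigma ^^ nat (- i))"

lemma sigma_pow_zero [simp]: "sigma_pow 0 r = r"
  by (simp add: sigma_pow_def)

lemma sigma_pow_one [simp]: "sigma_pow 1 r = sigma r"
  by (simp add: sigma_pow_def)

lemma sigma_pow_plus_one: "sigma_pow (i + 1) r = sigma (sigma_pow i r)"
proof (cases "i \<ge> 0")
  case True
  then show ?thesis by (simp add: sigma_pow_def nat_add_distrib)
next
  case False
  then have k: "nat (- i) = Suc (nat (- i - 1))" by simp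
  have "sigma_pow i r = sigma_inv (sigma_pow (i + 1) r)"
  proof (cases "i = -1")
    case False
    with \<open>\<not> i \<ge> 0\<close> show ?thesis
      by (simp add: sigma_pow_def inv_sigma k)
  qed (simp add: sigma_pow_def inv_sigma)
  then show ?thesis by simp
qed

lemma sigma_pow_add: "sigma_pow (i + j) r = sigma_pow i (sigma_pow j r)"
proof (induction i rule: int_induct[where k = 0])
  case base
  then show ?case by simp
next
  case (step1 i)
  have "i + 1 + j = (i + j) + 1" by simp
  then show ?case using step1 by (simp only: sigma_pow_plus_one)
next
  case (step2 i)
  have "sigma (sigma_pow (i - 1 + j) r) = sigma (sigma_pow (i - 1) (sigma_pow j r))"
    using step2 by (simp add: algebra_simps flip: sigma_pow_plus_one)
  then show ?case
    by (metis sigma_inv_sigma)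
qed

lemma sigma_inv_hom:
  "sigma_inv 0 = 0"
  "sigma_inv 1 = 1"
  "sigma_inv (r + s) = sigma_inv r + sigma_inv s"
  "sigma_inv (r * s) = sigma_inv r * sigma_inv s"
  subgoal by (metis sigma_0 sigma_inv_sigma)
  subgoal by (metis sigma_1 sigma_inv_sigma)
  subgoal by (metis sigma_add sigma_inv_sigma sigma_sigma_inv)
  subgoal by (metis sigma_mult sigma_inv_sigma sigma_sigma_inv)
  done

lemma sigma_pow_hom:
  "sigma_pow i 0 = 0"
  "sigma_pow i 1 = 1"
  "sigma_pow i (r + s) = sigma_pow i r + sigma_pow i s"
  "sigma_pow i (r * s) = sigma_pow i r * sigma_pow i s"
proof -
  have pos: "(sigma ^^ n) 0 = 0" "(sigma ^^ n) 1 = 1"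
    "(sigma ^^ n) (r + s) = (sigma ^^ n) r + (sigma ^^ n) s"
    "(sigma ^^ n) (r * s) = (sigma ^^ n) r * (sigma ^^ n) s" for n
    by (induction n) (simp_all add: sigma_add sigma_mult)
  have neg: "(sigma_inv ^^ n) 0 = 0" "(sigma_inv ^^ n) 1 = 1"
    "(sigma_inv ^^ n) (r + s) = (sigma_inv ^^ n) r + (sigma_inv ^^ n) s"
    "(sigma_inv ^^ n) (r * s) = (sigma_inv ^^ n) r * (sigma_inv ^^ n) s" for n
    by (induction n) (simp_all add: sigma_inv_hom)
  show "sigma_pow i 0 = 0" "sigma_pow i 1 = 1"
    "sigma_pow i (r + s) = sigma_pow i r + sigma_pow i s"
    "sigma_pow i (r * s) = sigma_pow i r * sigma_pow i s"
    by (simp_all add: sigma_pow_def inv_sigma pos neg)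
qed


section \<open>The skew Laurent polynomial ring \<open>B = K(H)[X, X\<^sup>-\<^sup>1; \<sigma>]\<close>\<close>

text \<open>An element \<open>\<Sum>\<^sub>i \<alpha>\<^sub>i X\<^sup>i\<close> is represented by its finitely supported family
  of left coefficients \<open>\<alpha>\<^sub>i\<close>. A separate type is needed because the multiplication
  of \<open>poly_mapping\<close> is the untwisted convolution.\<close>

typedef (overloaded) 'a skew_laurent = "UNIV :: (int \<Rightarrow>\<^sub>0 'a::field_char_0 poly fract) set"
  morphisms coeffs_of Abs_skew_laurent
  by simp

setup_lifting type_definition_skew_laurent
lifting_forget fract.lifting

lift_definition coeff_at :: "'a::field_char_0 skew_laurent \<Rightarrow> int \<Rightarrow> 'a poly fract"
  is Poly_Mapping.lookup .

text \<open>\<open>hom_elem \<alpha> n\<close> is the homogeneous element \<open>\<alpha> X\<^sup>n\<close>.\<close>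

lift_definition hom_elem :: "'a::field_char_0 poly fract \<Rightarrow> int \<Rightarrow> 'a skew_laurent"
  is "\<lambda>\<alpha> n. Poly_Mapping.single n \<alpha>" .

definition support :: "'a::field_char_0 skew_laurent \<Rightarrow> int set" where
  "support a = {i. coeff_at a i \<noteq> 0}"

lemma finite_support [simp]: "finite (support a)"
  unfolding support_def by transfer simp

lemma skew_laurent_eqI: "(\<And>i. coeff_at a i = coeff_at b i) \<Longrightarrow> a = b"
  by transfer (rule poly_mapping_eqI)

lemma coeff_at_hom_elem: "coeff_at (hom_elem \<alpha> n) i = (if i = n then \<alpha> else 0)"
  by transfer (simp add: lookup_single when_def)

instantiation skew_laurent :: (field_char_0) ab_group_add
begin

lift_definition zero_skew_laurent :: "'a skew_laurent" is 0 .
lift_definition plus_skew_laurent :: "'a skew_laurent \<Rightarrow> 'a skew_laurent \<Rightarrow> 'a skew_laurent"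
  is "(+)" .
lift_definition minus_skew_laurent :: "'a skew_laurent \<Rightarrow> 'a skew_laurent \<Rightarrow> 'a skew_laurent"
  is "(-)" .
lift_definition uminus_skew_laurent :: "'a skew_laurent \<Rightarrow> 'a skew_laurent"
  is "uminus" .

instance
  by standard (transfer; simp add: algebra_simps)+

end

lemma coeff_at_zero [simp]: "coeff_at 0 i = 0"
  by transfer simp

lemma coeff_at_add [simp]: "coeff_at (a + b) i = coeff_at a i + coeff_at b i"
  by transfer (simp add: lookup_add)

lemma coeff_at_sum: "coeff_at (sum f A) i = (\<Sum>x\<in>A. coeff_at (f x) i)"
  by (induction A rule: infinite_finite_induct) auto

lemma hom_elem_zero [simp]: "hom_elem 0 n = 0"
  by transfer simp

lemma hom_elem_add: "hom_elem (\<alpha> + \<beta>) n = hom_elem \<alpha> n + hom_elem \<beta> n"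
  by transfer (simp add: single_add)

lemma skew_laurent_decomp:
  assumes "finite A" "support a \<subseteq> A"
  shows "a = (\<Sum>i\<in>A. hom_elem (coeff_at a i) i)"
  using assms by (intro skew_laurent_eqI) (auto simp: coeff_at_sum coeff_at_hom_elem support_def)

text \<open>The multiplication is determined by
  \<open>\<alpha> X\<^sup>i \<cdot> \<beta> X\<^sup>j = \<alpha> \<sigma>\<^sup>i(\<beta>) X\<^sup>(\<^sup>i\<^sup>+\<^sup>j\<^sup>)\<close>.\<close>

instantiation skew_laurent :: (field_char_0) ring_1
begin

definition one_skew_laurent :: "'a skew_laurent" where
  "1 = hom_elem 1 0"

definition times_skew_laurent :: "'a skew_laurent \<Rightarrow> 'a skew_laurent \<Rightarrow> 'a skew_laurent" where
  "a * b = (\<Sum>i\<in>support a. \<Sum>j\<in>support b.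
     hom_elem (coeff_at a i * sigma_pow i (coeff_at b j)) (i + j))"

instance
proof
  have times_on: "x * y = (\<Sum>i\<in>A. \<Sum>j\<in>C.
      hom_elem (coeff_at x i * sigma_pow i (coeff_at y j)) (i + j))"
    if "finite A" "support x \<subseteq> A" "finite C" "support y \<subseteq> C" for x y :: "'a skew_laurent" and A C
  proof -
    have "x * y = (\<Sum>i\<in>support x. \<Sum>j\<in>C.
        hom_elem (coeff_at x i * sigma_pow i (coeff_at y j)) (i + j))"
      unfolding times_skew_laurent_def using that
      by (intro sum.cong[OF refl] sum.mono_neutral_left) (auto simp: support_def sigma_pow_hom)
    also have "\<dots> = (\<Sum>i\<in>A. \<Sum>j\<in>C.
        hom_elem (coeff_at x i * sigma_pow i (coeff_at y j)) (i + j))"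
      using that by (intro sum.mono_neutral_left) (auto simp: support_def)
    finally show ?thesis .
  qed
  have supp_add: "support (x + y) \<subseteq> support x \<union> support y" for x y :: "'a skew_laurent"
    by (auto simp: support_def)
  have dist_r: "(x + y) * z = x * z + y * z" for x y z :: "'a skew_laurent"
    using supp_add[of x y]
    by (simp add: times_on[of "support x \<union> support y" _ "support z"] algebra_simps
        sum.distrib hom_elem_add)
  have dist_l: "x * (y + z) = x * y + x * z" for x y z :: "'a skew_laurent"
    using supp_add[of y z]
    by (simp add: times_on[of "support x" _ "support y \<union> support z"] algebra_simps
        sigma_pow_hom sum.distrib hom_elem_add)
  have hom_mult: "hom_elem \<alpha> m * hom_elem \<beta> n = hom_elem (\<alpha> * sigma_pow m \<beta>) (m + n)"
    for \<alpha> \<beta> :: "'a poly fract" and m n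
    by (subst times_on[of "{m}" _ "{n}"]) (auto simp: support_def coeff_at_hom_elem split: if_splits)
  have zero_l: "0 * x = 0" and zero_r: "x * 0 = 0" for x :: "'a skew_laurent"
    using dist_r[of 0 0 x] dist_l[of x 0 0] by (simp_all only: add_0_right add_cancel_right_right)
  have sum_l: "sum f A * x = (\<Sum>i\<in>A. f i * x)"
    and sum_r: "x * sum f A = (\<Sum>i\<in>A. x * f i)" for f and A :: "int set" and x :: "'a skew_laurent"
    by (induction A rule: infinite_finite_induct; simp add: zero_l zero_r dist_l dist_r)+
  have decomp: "\<exists>f. x = (\<Sum>i\<in>support x. hom_elem (f i) i)" for x :: "'a skew_laurent"
    by (rule exI[of _ "coeff_at x"], rule skew_laurent_decomp) auto
  fix a b c :: "'a skew_laurent"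
  from decomp obtain f where f: "a = (\<Sum>i\<in>support a. hom_elem (f i) i)" by blast
  from decomp obtain g where g: "b = (\<Sum>i\<in>support b. hom_elem (g i) i)" by blast
  from decomp obtain h where h: "c = (\<Sum>i\<in>support c. hom_elem (h i) i)" by blast
  note fgh = f g h
  have assoc: "(\<Sum>i\<in>A. hom_elem (f i) i) * (\<Sum>i\<in>C. hom_elem (g i) i) * (\<Sum>i\<in>D. hom_elem (h i) i) =
    (\<Sum>i\<in>A. hom_elem (f i) i) * ((\<Sum>i\<in>C. hom_elem (g i) i) * (\<Sum>i\<in>D. hom_elem (h i) i))"
    for A C D
    by (simp add: sum_l sum_r hom_mult sigma_pow_hom mult.assoc add.assoc flip: sigma_pow_add)
  show "a * b * c = a * (b * c)"
    using assoc[of "support a" "support b" "support c"] by (simp only: fgh[symmetric])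
  have "1 * (\<Sum>i\<in>A. hom_elem (f i) i) = (\<Sum>i\<in>A. hom_elem (f i) i)"
    "(\<Sum>i\<in>A. hom_elem (f i) i) * 1 = (\<Sum>i\<in>A. hom_elem (f i) i)" for A
    by (simp_all add: one_skew_laurent_def sum_l sum_r hom_mult sigma_pow_hom)
  from this[of "support a"] show "1 * a = a" "a * 1 = a"
    by (simp_all only: f[symmetric])
  show "(a + b) * c = a * c + b * c" by (rule dist_r)
  show "a * (b + c) = a * b + a * c" by (rule dist_l)
  show "(0 :: 'a skew_laurent) \<noteq> 1"
  proof
    assume "(0 :: 'a skew_laurent) = 1"
    then have "coeff_at (0 :: 'a skew_laurent) 0 = coeff_at 1 0" by simp
    then show False by (simp add: one_skew_laurent_def coeff_at_hom_elem)
  qed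
qed

end

lemma support_hom_elem: "support (hom_elem \<alpha> n) = (if \<alpha> = 0 then {} else {n})"
  by (auto simp: support_def coeff_at_hom_elem)

lemma hom_elem_mult:
  "hom_elem \<alpha> m * hom_elem \<beta> n = hom_elem (\<alpha> * sigma_pow m \<beta>) (m + n)"
proof (cases "\<alpha> = 0 \<or> \<beta> = 0")
  case True
  then show ?thesis by (elim disjE) (simp_all add: sigma_pow_hom(1))
next
  case False
  then show ?thesis
    by (simp add: times_skew_laurent_def support_hom_elem coeff_at_hom_elem)
qed

definition ratfun_elem :: "'a::field_char_0 poly fract \<Rightarrow> 'a skew_laurent" where
  "ratfun_elem r = hom_elem r 0"

definition const_elem :: "'a::field_char_0 \<Rightarrow> 'a skew_laurent" where
  "const_elem c = ratfun_elem (ratfun_const c)"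

definition X_elem :: "'a::field_char_0 skew_laurent" where
  "X_elem = hom_elem 1 1"

lemma X_ratfun_commute: "X_elem * ratfun_elem r = ratfun_elem (sigma r) * X_elem"
  by (simp add: X_elem_def ratfun_elem_def hom_elem_mult sigma_pow_hom)

lemma hom_elem_eq_X_power:
  fixes r :: "'a::field_char_0 poly fract"
  shows "hom_elem r (int n) = ratfun_elem r * X_elem ^ n"
proof -
  have "X_elem ^ n = (hom_elem 1 (int n) :: 'a skew_laurent)"
    by (induction n) (simp_all add: one_skew_laurent_def X_elem_def hom_elem_mult sigma_pow_hom)
  then show ?thesis by (simp add: ratfun_elem_def hom_elem_mult sigma_pow_hom(2))
qed

lemma X_inverse: "X_elem * hom_elem 1 (- 1) = 1" "hom_elem 1 (- 1) * X_elem = 1"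
  by (simp_all add: X_elem_def one_skew_laurent_def hom_elem_mult sigma_pow_hom(2))

lemma hom_elem_eq_X_inverse_power:
  fixes r :: "'a::field_char_0 poly fract"
  shows "hom_elem r (- int n) = ratfun_elem r * hom_elem 1 (- 1) ^ n"
proof -
  have "hom_elem 1 (- 1) ^ n = (hom_elem 1 (- int n) :: 'a skew_laurent)"
    by (induction n) (simp_all add: one_skew_laurent_def hom_elem_mult sigma_pow_hom(2))
  then show ?thesis by (simp add: ratfun_elem_def hom_elem_mult sigma_pow_hom(2))
qed


section \<open>Centralizers and Laurent polynomial subrings\<close>

definition centralizer :: "'a::field_char_0 skew_laurent \<Rightarrow> 'a skew_laurent set" where
  "centralizer u = {b. u * b = b * u}"

inductive_set subalgebra_gen :: "'a::field_char_0 skew_laurent set \<Rightarrow> 'a skew_laurent set"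
  for S where
  incl: "x \<in> S \<Longrightarrow> x \<in> subalgebra_gen S"
| const: "const_elem c \<in> subalgebra_gen S"
| add: "x \<in> subalgebra_gen S \<Longrightarrow> y \<in> subalgebra_gen S \<Longrightarrow> x + y \<in> subalgebra_gen S"
| mult: "x \<in> subalgebra_gen S \<Longrightarrow> y \<in> subalgebra_gen S \<Longrightarrow> x * y \<in> subalgebra_gen S"

text \<open>\<open>A = K[v, v\<^sup>-\<^sup>1]\<close>, and this is a Laurent polynomial ring in the variable \<open>v\<close>:
  \<open>v\<close> is a unit of \<open>B\<close>, \<open>A\<close> is the \<open>K\<close>-subalgebra generated by \<open>v\<close> and \<open>v\<^sup>-\<^sup>1\<close>, and there
  is an isomorphism of \<open>K\<close>-algebras \<open>\<phi>\<close> from the Laurent polynomials \<open>K[t, t\<^sup>-\<^sup>1]\<close> onto \<open>A\<close>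
  with \<open>\<phi>(t) = v\<close>. Here \<open>K[t, t\<^sup>-\<^sup>1]\<close> is the group algebra \<open>int \<Rightarrow>\<^sub>0 'a\<close> of the integers.\<close>

definition laurent_ring_in ::
    "'a::field_char_0 skew_laurent set \<Rightarrow> 'a skew_laurent \<Rightarrow> bool" where
  "laurent_ring_in A v \<longleftrightarrow>
     (\<exists>w. v * w = 1 \<and> w * v = 1 \<and> A = subalgebra_gen {v, w}) \<and>
     (\<exists>\<phi> :: (int \<Rightarrow>\<^sub>0 'a) \<Rightarrow> 'a skew_laurent.
        bij_betw \<phi> UNIV A \<and>
        (\<forall>p q. \<phi> (p + q) = \<phi> p + \<phi> q) \<and>
        (\<forall>p q. \<phi> (p * q) = \<phi> p * \<phi> q) \<and>
        (\<forall>c. \<phi> (Poly_Mapping.single 0 c) = const_elem c) \<and>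
        \<phi> (Poly_Mapping.single 1 1) = v)"


section \<open>Twisted roots\<close>

text \<open>For a positive divisor \<open>s\<close> of \<open>n \<noteq> 0\<close>, this says
  \<open>\<beta> \<sigma>\<^sup>\<plusminus>\<^sup>s(\<beta>) \<sigma>\<^sup>\<plusminus>\<^sup>2\<^sup>s(\<beta>) \<dots> = \<alpha>\<close> with \<open>\<bar>n\<bar>/s\<close> factors and the sign of \<open>n\<close>;
  equivalently, \<open>(\<beta> X\<^sup>\<plusminus>\<^sup>s)\<close> raised to the power \<open>\<bar>n\<bar>/s\<close> is \<open>\<alpha> X\<^sup>n\<close>.
  It places no constraint for \<open>n = 0\<close>, which is never used.\<close>

definition twisted_root ::
    "'a::field_char_0 poly fract \<Rightarrow> int \<Rightarrow> nat \<Rightarrow> 'a poly fract \<Rightarrow> bool" where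
  "twisted_root \<alpha> n s \<beta> \<longleftrightarrow>
     (n > 0 \<longrightarrow> (\<Prod>j<nat n div s. sigma_pow (int (j * s)) \<beta>) = \<alpha>) \<and>
     (n < 0 \<longrightarrow> (\<Prod>j<nat \<bar>n\<bar> div s. sigma_pow (- int (j * s)) \<beta>) = \<alpha>)"

definition minimal_root_divisor ::
    "'a::field_char_0 poly fract \<Rightarrow> int \<Rightarrow> nat \<Rightarrow> bool" where
  "minimal_root_divisor \<alpha> n s \<longleftrightarrow>
     is_arg_min id (\<lambda>t. 0 < t \<and> int t dvd n \<and> (\<exists>\<beta>. twisted_root \<alpha> n t \<beta>)) s"

end

theory Submission
  imports Defs
begin

text \<open>
  The centralizer of a homogeneous element is spanned by its homogeneous elements. If two of them
  have the same degree, their quotient is fixed by \<open>\<sigma>\<^sup>n\<close> and hence constant, so every component of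
  \<open>C(\<alpha> X\<^sup>n, B)\<close> is at most one-dimensional and contains at most one monic element. The degrees of
  these monic elements form a subgroup \<open>s \<int>\<close> of \<open>\<int>\<close>; the monic elements of degrees \<open>\<plusminus>s\<close> generate
  the centralizer, and by uniqueness a power of one of them is \<open>\<alpha> X\<^sup>n\<close> itself. Conversely, a
  root of \<open>\<alpha> X\<^sup>n\<close> commutes with it, so that its degree is a multiple of \<open>s\<close>.
\<close>

section \<open>Constants and monic rational functions\<close>

lemma ratfun_const_0 [simp]: "ratfun_const 0 = 0"
  and ratfun_const_1 [simp]: "ratfun_const 1 = 1"
  and ratfun_const_add: "ratfun_const (c + d) = ratfun_const c + ratfun_const d"
  and ratfun_const_mult: "ratfun_const (c * d) = ratfun_const c * ratfun_const d"
  by (simp_all add: ratfun_const_def Zero_fract_def One_fract_def one_pCons mult.commute)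

lemma ratfun_const_power: "ratfun_const (c ^ k) = ratfun_const c ^ k"
  by (induction k) (simp_all add: ratfun_const_mult)

lemma ratfun_const_eq_iff [simp]: "ratfun_const c = ratfun_const d \<longleftrightarrow> c = d"
  by (simp add: ratfun_const_def eq_fract)

lemma ratfun_const_eq_0_iff [simp]: "ratfun_const c = 0 \<longleftrightarrow> c = 0"
  using ratfun_const_eq_iff[of c 0] by (simp del: ratfun_const_eq_iff)

lemma ratfun_const_eq_1_iff [simp]: "ratfun_const c = 1 \<longleftrightarrow> c = 1"
  using ratfun_const_eq_iff[of c 1] by (simp del: ratfun_const_eq_iff)

section \<open>Powers of \<sigma> with exponents of either sign\<close>

lemma sigma_inv_const: "sigma_inv (ratfun_const c) = ratfun_const c"
  by (metis sigma_const sigma_inv_sigma)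

text \<open>As \<open>sigma_pow\<close> branches on the sign of its exponent, an invariance claim
  reduces to single steps of \<sigma> and of its inverse. Used for constants and for monic
  functions.\<close>

lemma sigma_pow_preserves:
  assumes "P r" "\<And>r. P r \<Longrightarrow> P (sigma r)" "\<And>r. P r \<Longrightarrow> P (sigma_inv r)"
  shows "P (sigma_pow i r)"
proof -
  have "P ((sigma ^^ k) r)" "P ((sigma_inv ^^ k) r)" for k
    by (induction k) (simp_all add: assms)
  then show ?thesis by (simp add: sigma_pow_def inv_sigma)
qed

lemma sigma_pow_const [simp]: "sigma_pow i (ratfun_const c) = ratfun_const c"
  by (rule sigma_pow_preserves) (simp_all add: sigma_const sigma_inv_const)

lemma sigma_pow_inverse: "sigma_pow i (inverse r) = inverse (sigma_pow i r)"
proof (cases "r = 0")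
  case False
  then have "sigma_pow i r * sigma_pow i (inverse r) = 1"
    by (simp add: sigma_pow_hom flip: sigma_pow_hom(4))
  then show ?thesis by (simp add: inverse_unique)
qed (simp add: sigma_pow_hom)

lemma sigma_pow_minus_cancel [simp]: "sigma_pow i (sigma_pow (- i) r) = r"
  by (simp flip: sigma_pow_add)

lemma sigma_pow_eq_0_iff [simp]: "sigma_pow i r = 0 \<longleftrightarrow> r = 0"
proof
  assume "sigma_pow i r = 0"
  moreover have "sigma_pow (- i) (sigma_pow i r) = r"
    using sigma_pow_minus_cancel[of "- i" r] by simp
  ultimately show "r = 0" by (simp add: sigma_pow_hom)
qed (simp add: sigma_pow_hom)

section \<open>Closure properties and rigidity of monic rational functions\<close>

lemma monic_ratfun_1: "monic_ratfun 1"
  unfolding monic_ratfun_def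
  by (rule exI[of _ 1], rule exI[of _ 1], intro conjI lead_coeff_1 One_fract_def)

lemma monic_ratfun_mult:
  "monic_ratfun (r * s)" if "monic_ratfun r" "monic_ratfun s"
proof -
  from that obtain f g f' g' where
    "lead_coeff f = 1" "lead_coeff g = 1" "r = Fract f g"
    "lead_coeff f' = 1" "lead_coeff g' = 1" "s = Fract f' g'"
    unfolding monic_ratfun_def by blast
  then have "lead_coeff (f * f') = 1" "lead_coeff (g * g') = 1" "r * s = Fract (f * f') (g * g')"
    by (simp_all only: lead_coeff_mult mult_fract mult_1)
  then show ?thesis unfolding monic_ratfun_def by blast
qed

lemma monic_ratfun_inverse: "monic_ratfun (inverse r)" if "monic_ratfun r"
proof -
  from that obtain f g where "lead_coeff f = 1" "lead_coeff g = 1" "r = Fract f g"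
    unfolding monic_ratfun_def by blast
  then have "lead_coeff g = 1" "lead_coeff f = 1" "inverse r = Fract g f" by simp_all
  then show ?thesis unfolding monic_ratfun_def by blast
qed

lemma monic_ratfun_nonzero:
  assumes "monic_ratfun r"
  shows "r \<noteq> 0"
proof -
  obtain f g where fg: "lead_coeff f = 1" "lead_coeff g = 1" "r = Fract f g"
    using assms unfolding monic_ratfun_def by blast
  then have "f \<noteq> 0" "g \<noteq> 0" by auto
  with fg show ?thesis by (simp add: Zero_fract_def eq_fract)
qed

lemma lead_coeff_pcompose_shift: "lead_coeff (pcompose p [:c, 1:]) = lead_coeff p"
  for p :: "'a::field_char_0 poly"
  by (subst lead_coeff_comp) auto

lemma monic_ratfun_sigma_pow: "monic_ratfun r \<Longrightarrow> monic_ratfun (sigma_pow i r)"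
proof (erule sigma_pow_preserves)
  show "monic_ratfun (sigma r)" if "monic_ratfun r" for r :: "'a poly fract"
    using that unfolding monic_ratfun_def by (metis sigma_Fract lead_coeff_pcompose_shift)
  show "monic_ratfun (sigma_inv r)" if "monic_ratfun r" for r :: "'a poly fract"
    using that unfolding monic_ratfun_def by (metis sigma_inv_Fract lead_coeff_pcompose_shift)
qed

text \<open>Clearing the denominator gives \<open>smult c g = f\<close>, and leading coefficients
  are compared. This is the source of all uniqueness claims for monic elements.\<close>

lemma monic_ratfun_const_iff [simp]: "monic_ratfun (ratfun_const c) \<longleftrightarrow> c = 1"
proof
  assume "monic_ratfun (ratfun_const c)"
  then obtain f g where fg: "lead_coeff f = 1" "lead_coeff g = 1" "ratfun_const c = Fract f g"
    unfolding monic_ratfun_def by blast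
  then have "g \<noteq> 0" by auto
  with fg have "smult c g = f" by (simp add: ratfun_const_def eq_fract)
  then have "lead_coeff f = c * lead_coeff g" by (metis lead_coeff_smult)
  with fg show "c = 1" by simp
qed (simp add: monic_ratfun_1)

text \<open>The quotient of the two leading coefficients is split off. Later arguments use this to
  replace a nonzero coefficient by a monic one.\<close>

lemma ratfun_eq_const_mult_monic:
  assumes "r \<noteq> 0"
  obtains c s where "c \<noteq> 0" "monic_ratfun s" "r = ratfun_const c * s"
proof -
  obtain f g where r: "r = Fract f g" "f \<noteq> 0" "g \<noteq> 0"
    using assms by (cases r rule: Fract_cases_nonzero) auto
  define a b where "a = lead_coeff f" and "b = lead_coeff g"
  have ab: "a \<noteq> 0" "b \<noteq> 0" using r by (auto simp: a_def b_def)
  show thesis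
  proof (rule that)
    show "a / b \<noteq> 0" using ab by simp
    show "monic_ratfun (Fract (smult (1 / a) f) (smult (1 / b) g))"
      unfolding monic_ratfun_def
      by (rule exI[of _ "smult (1 / a) f"], rule exI[of _ "smult (1 / b) g"])
        (use ab in \<open>simp add: a_def b_def\<close>)
    show "r = ratfun_const (a / b) * Fract (smult (1 / a) f) (smult (1 / b) g)"
      using ab r by (simp add: ratfun_const_def eq_fract)
  qed
qed

lemma monic_const_mult_eq:
  assumes "monic_ratfun r" "monic_ratfun s" "r = ratfun_const c * s"
  shows "r = s"
proof -
  have "ratfun_const c = r * inverse s"
    using assms monic_ratfun_nonzero[of s] by (simp add: field_simps)
  then have "monic_ratfun (ratfun_const c)"
    using assms by (metis monic_ratfun_mult monic_ratfun_inverse)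
  then show ?thesis using assms by simp
qed


section \<open>Fixed points of \<open>\<sigma>\<^sup>n\<close>\<close>

lemma sigma_pow_of_nat_Fract:
  "sigma_pow (int k) (Fract f g) = Fract (pcompose f [:- of_nat k, 1:]) (pcompose g [:- of_nat k, 1:])"
proof (induction k)
  case (Suc k)
  have "pcompose (pcompose p [:- of_nat k, 1:]) [:- 1, 1:] = pcompose p [:- of_nat (Suc k), 1:]"
    for p :: "'a poly"
    by (simp add: pcompose_pCons minus_diff_commute flip: pcompose_assoc)
  with Suc show ?case
    using sigma_pow_plus_one[of "int k" "Fract f g"] by (simp add: sigma_Fract add.commute)
qed simp

text \<open>If \<open>f/g\<close> has period \<open>k\<close>, it takes the same value \<open>c\<close> along an infinite arithmetic
  progression avoiding the zeros of \<open>g\<close>, so that \<open>f - c g\<close> has infinitely many roots.\<close>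

lemma sigma_pow_of_nat_fixed_imp_const:
  assumes "k > 0" "sigma_pow (int k) r = r"
  shows "r \<in> range ratfun_const"
proof -
  obtain f g where r: "r = Fract f g" "g \<noteq> 0" by (cases r) auto
  let ?s = "[:- of_nat k, 1:] :: 'a poly"
  have "pcompose g ?s \<noteq> 0" using r by (simp add: pcompose_shift_eq_0_iff)
  with assms r have eq: "pcompose f ?s * g = f * pcompose g ?s"
    by (simp add: sigma_pow_of_nat_Fract eq_fract)
  have periodic: "poly f (x - of_nat k) * poly g x = poly f x * poly g (x - of_nat k)" for x
    using arg_cong[OF eq, of "\<lambda>p. poly p x"] by (simp add: poly_pcompose)
  \<comment> \<open>In characteristic zero the naturals embed in K, so the nonzero polynomial
    \<open>g\<close> vanishes at only finitely many of them.\<close>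
  have "finite {m. poly g (of_nat m) = 0}"
    using finite_vimageI[OF poly_roots_finite[OF r(2)], of of_nat]
    by (simp add: vimage_def inj_on_def)
  then obtain N where "\<forall>m \<in> {m. poly g (of_nat m) = 0}. m < N"
    using finite_nat_set_iff_bounded by blast
  then have g_nz: "poly g (of_nat m) \<noteq> 0" if "m \<ge> N" for m
    using that by (meson leD mem_Collect_eq)
  define c where "c = poly f (of_nat N) / poly g (of_nat N)"
  have progression: "poly f (of_nat (N + j * k)) = c * poly g (of_nat (N + j * k))" for j
  proof (induction j)
    case 0
    then show ?case using g_nz[of N] by (simp add: c_def)
  next
    case (Suc j)
    have "of_nat (N + Suc j * k) - of_nat k = (of_nat (N + j * k) :: 'a)"
      by (simp add: algebra_simps)
    then have "c * poly g (of_nat (N + j * k)) * poly g (of_nat (N + Suc j * k))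
        = poly f (of_nat (N + Suc j * k)) * poly g (of_nat (N + j * k))"
      using periodic[of "of_nat (N + Suc j * k)"] Suc by simp
    then show ?case using g_nz[of "N + j * k"] by simp
  qed
  \<comment> \<open>The points of the progression are distinct because \<open>k > 0\<close> and K
    has characteristic zero.\<close>
  have "inj (\<lambda>j. of_nat (N + j * k) :: 'a)"
    using assms(1) by (intro injI) (simp only: of_nat_eq_iff, simp)
  then have "infinite (range (\<lambda>j. of_nat (N + j * k) :: 'a))"
    by (rule range_inj_infinite)
  moreover have "range (\<lambda>j. of_nat (N + j * k) :: 'a) \<subseteq> {x. poly (f - smult c g) x = 0}"
    using progression by auto
  ultimately have "f - smult c g = 0"
    using poly_roots_finite finite_subset by blast
  then have "r = ratfun_const c" using r by (simp add: ratfun_const_def eq_fract)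
  then show ?thesis by blast
qed

lemma sigma_pow_fixed_imp_const:
  assumes "n \<noteq> 0" "sigma_pow n r = r"
  shows "r \<in> range ratfun_const"
proof (cases "n > 0")
  case True
  then show ?thesis
    using sigma_pow_of_nat_fixed_imp_const[of "nat n" r] assms by simp
next
  case False
  \<comment> \<open>Being fixed by a power of \<sigma> is the same as being fixed by its inverse, so
    a negative exponent can be made positive.\<close>
  have "sigma_pow (- n) r = r"
    using assms(2) sigma_pow_minus_cancel[of "- n" r] by simp
  with False show ?thesis
    using sigma_pow_of_nat_fixed_imp_const[of "nat (- n)" r] assms(1) by simp
qed


section \<open>Homogeneous elements and centralizers\<close>

lemma hom_elem_eq_iff: "hom_elem r m = hom_elem s m \<longleftrightarrow> r = s"
  by (auto simp: coeff_at_hom_elem dest: arg_cong[of _ _ "\<lambda>x. coeff_at x m"])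

lemma const_elem_mult_hom_elem: "const_elem c * hom_elem r m = hom_elem (ratfun_const c * r) m"
  by (simp add: const_elem_def ratfun_elem_def hom_elem_mult)

lemma hom_elem_power:
  "hom_elem \<beta> e ^ k = hom_elem (\<Prod>j<k. sigma_pow (int j * e) \<beta>) (int k * e)"
proof (induction k)
  case (Suc k)
  have "hom_elem \<beta> e ^ Suc k = hom_elem \<beta> e ^ k * hom_elem \<beta> e"
    by (rule power_Suc2)
  then show ?case using Suc by (simp add: hom_elem_mult algebra_simps)
qed (simp add: one_skew_laurent_def)

lemma hom_elem_const_mult_power:
  "hom_elem (ratfun_const c * \<beta>) e ^ k = const_elem (c ^ k) * hom_elem \<beta> e ^ k"
proof -
  have "(\<Prod>j<k. sigma_pow (int j * e) (ratfun_const c * \<beta>))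
      = ratfun_const (c ^ k) * (\<Prod>j<k. sigma_pow (int j * e) \<beta>)"
    by (simp add: sigma_pow_hom prod.distrib ratfun_const_power)
  then show ?thesis by (simp add: hom_elem_power const_elem_mult_hom_elem)
qed

text \<open>By divisibility, the degrees of the \<open>nat \<bar>n\<bar> div s\<close> equal factors
  add up to exactly \<open>n\<close>, so only coefficients remain to be compared. The factor
  \<open>sgn n\<close> treats both signs at once, and a root is now seen to commute with its
  power.\<close>

lemma twisted_root_iff_power:
  assumes "n \<noteq> 0" "int s dvd n"
  shows "twisted_root \<alpha> n s \<beta> \<longleftrightarrow>
    hom_elem \<beta> (sgn n * int s) ^ (nat \<bar>n\<bar> div s) = hom_elem \<alpha> n"
proof -
  have "int (nat \<bar>n\<bar> div s) * (sgn n * int s) = sgn n * (\<bar>n\<bar> div int s * int s)"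
    by (simp add: zdiv_int)
  also have "\<dots> = n" using assms(2) by (simp add: sgn_mult_abs)
  finally show ?thesis
    using assms(1) by (cases "n > 0") (auto simp: twisted_root_def hom_elem_power hom_elem_eq_iff)
qed

section \<open>Commutation with a homogeneous element, degree by degree\<close>

lemma coeff_at_hom_elem_mult:
  "coeff_at (hom_elem \<alpha> n * x) m = \<alpha> * sigma_pow n (coeff_at x (m - n))"
proof (cases "\<alpha> = 0")
  case False
  then have "coeff_at (hom_elem \<alpha> n * x) m =
      (\<Sum>j\<in>support x. coeff_at (hom_elem (\<alpha> * sigma_pow n (coeff_at x j)) (n + j)) m)"
    unfolding times_skew_laurent_def
    by (simp add: support_hom_elem coeff_at_sum coeff_at_hom_elem[of \<alpha> n])
  also have "\<dots> = (\<Sum>j\<in>support x. if j = m - n then \<alpha> * sigma_pow n (coeff_at x j) else 0)"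
    by (rule sum.cong) (auto simp: coeff_at_hom_elem)
  also have "\<dots> = (if m - n \<in> support x then \<alpha> * sigma_pow n (coeff_at x (m - n)) else 0)"
    by simp
  finally show ?thesis by (simp add: support_def sigma_pow_hom)
qed simp

lemma coeff_at_mult_hom_elem:
  "coeff_at (x * hom_elem \<alpha> n) m = coeff_at x (m - n) * sigma_pow (m - n) \<alpha>"
proof (cases "\<alpha> = 0")
  case False
  then have "coeff_at (x * hom_elem \<alpha> n) m =
      (\<Sum>j\<in>support x. coeff_at (hom_elem (coeff_at x j * sigma_pow j \<alpha>) (j + n)) m)"
    unfolding times_skew_laurent_def
    by (simp add: support_hom_elem coeff_at_sum coeff_at_hom_elem[of \<alpha> n])
  also have "\<dots> = (\<Sum>j\<in>support x. if j = m - n then coeff_at x j * sigma_pow j \<alpha> else 0)"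
    by (rule sum.cong) (auto simp: coeff_at_hom_elem)
  also have "\<dots> = (if m - n \<in> support x then coeff_at x (m - n) * sigma_pow (m - n) \<alpha> else 0)"
    by simp
  finally show ?thesis by (simp add: support_def)
qed (simp add: sigma_pow_hom)

lemma hom_elem_mem_centralizer_iff:
  "hom_elem \<gamma> m \<in> centralizer (hom_elem \<alpha> n) \<longleftrightarrow> \<alpha> * sigma_pow n \<gamma> = \<gamma> * sigma_pow m \<alpha>"
  by (simp add: centralizer_def hom_elem_mult add.commute[of m n] hom_elem_eq_iff)

text \<open>Multiplication by a homogeneous element of degree \<open>n\<close> on either side shifts
  all degrees by \<open>n\<close>, so the commutation equation in degree \<open>m + n\<close>
  involves only the component of degree \<open>m\<close>.\<close>

lemma mem_centralizer_hom_elem_iff: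
  "x \<in> centralizer (hom_elem \<alpha> n) \<longleftrightarrow>
    (\<forall>m. hom_elem (coeff_at x m) m \<in> centralizer (hom_elem \<alpha> n))"
proof
  assume "x \<in> centralizer (hom_elem \<alpha> n)"
  then have "coeff_at (hom_elem \<alpha> n * x) (m + n) = coeff_at (x * hom_elem \<alpha> n) (m + n)" for m
    by (simp add: centralizer_def)
  then show "\<forall>m. hom_elem (coeff_at x m) m \<in> centralizer (hom_elem \<alpha> n)"
    by (simp add: hom_elem_mem_centralizer_iff coeff_at_hom_elem_mult coeff_at_mult_hom_elem)
next
  assume "\<forall>m. hom_elem (coeff_at x m) m \<in> centralizer (hom_elem \<alpha> n)"
  then have "coeff_at (hom_elem \<alpha> n * x) m = coeff_at (x * hom_elem \<alpha> n) m" for m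
    by (simp add: hom_elem_mem_centralizer_iff coeff_at_hom_elem_mult coeff_at_mult_hom_elem)
  then show "x \<in> centralizer (hom_elem \<alpha> n)"
    unfolding centralizer_def by (simp add: skew_laurent_eqI)
qed

section \<open>The homogeneous components of a centralizer\<close>

lemma centralizer_mult: "x \<in> centralizer u \<Longrightarrow> y \<in> centralizer u \<Longrightarrow> x * y \<in> centralizer u"
  unfolding centralizer_def mem_Collect_eq by (metis mult.assoc)

lemma centralizer_inverse:
  assumes "x \<in> centralizer u" "x * y = 1" "y * x = 1"
  shows "y \<in> centralizer u"
proof -
  have "u * y = y * x * u * y" using assms by simp
  also have "\<dots> = y * (u * x) * y" using assms(1) by (simp add: centralizer_def mult.assoc)
  also have "\<dots> = y * u" using assms(2) by (simp add: mult.assoc)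
  finally show ?thesis by (simp add: centralizer_def)
qed

text \<open>The quotient of two elements centralizing \<open>\<alpha> X\<^sup>n\<close> in the same degree is fixed by \<open>\<sigma>\<^sup>n\<close>.\<close>

lemma centralizer_component_one_dim:
  assumes "\<alpha> \<noteq> 0" "n \<noteq> 0" "\<delta> \<noteq> 0"
    and "hom_elem \<gamma> m \<in> centralizer (hom_elem \<alpha> n)" "hom_elem \<delta> m \<in> centralizer (hom_elem \<alpha> n)"
  obtains c where "\<gamma> = ratfun_const c * \<delta>"
proof -
  \<comment> \<open>Applying \<open>sigma_pow n\<close> multiplies both \<gamma> and \<delta> by the
    same factor \<open>sigma_pow m \<alpha> / \<alpha>\<close>, which cancels in their
    quotient.\<close>
  have "sigma_pow n \<gamma> = \<gamma> * sigma_pow m \<alpha> / \<alpha>" "sigma_pow n \<delta> = \<delta> * sigma_pow m \<alpha> / \<alpha>"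
    using assms by (simp_all add: hom_elem_mem_centralizer_iff field_simps)
  then have "sigma_pow n \<gamma> * \<delta> = \<gamma> * sigma_pow n \<delta>"
    by simp
  then have "sigma_pow n (\<gamma> * inverse \<delta>) = \<gamma> * inverse \<delta>"
    unfolding sigma_pow_hom(4) sigma_pow_inverse using assms(3) by (simp add: divide_simps)
  then obtain c where "\<gamma> * inverse \<delta> = ratfun_const c"
    using sigma_pow_fixed_imp_const[OF assms(2)] by blast
  then show thesis using that[of c] assms(3) by (simp add: field_simps)
qed

text \<open>The two coefficients differ by a constant factor, and monicity forces that factor to be
  1.\<close>

lemma centralizer_monic_unique:
  assumes "\<alpha> \<noteq> 0" "n \<noteq> 0" "monic_ratfun \<gamma>" "monic_ratfun \<delta>"
    and "hom_elem \<gamma> m \<in> centralizer (hom_elem \<alpha> n)" "hom_elem \<delta> m \<in> centralizer (hom_elem \<alpha> n)"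
  shows "\<gamma> = \<delta>"
  using centralizer_component_one_dim[OF assms(1,2) _ assms(5,6)]
  by (metis assms(3,4) monic_const_mult_eq monic_ratfun_nonzero)

lemma centralizer_const_mult_iff:
  assumes "c \<noteq> 0"
  shows "hom_elem (ratfun_const c * \<gamma>) m \<in> centralizer (hom_elem \<alpha> n)
    \<longleftrightarrow> hom_elem \<gamma> m \<in> centralizer (hom_elem \<alpha> n)"
  using assms by (auto simp: hom_elem_mem_centralizer_iff sigma_pow_hom mult.left_commute mult.assoc)

text \<open>A nonzero component of degree \<open>m\<close> commuting with \<open>r\<close> gives
  \<open>sigma_pow m r = r\<close>; for nonzero \<open>m\<close> this would make \<open>r\<close>
  constant. Degree 0 is commutative.\<close>

lemma centralizer_ratfun_elem:
  assumes "r \<notin> range ratfun_const"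
  shows "centralizer (ratfun_elem r) = range ratfun_elem"
proof (intro equalityI subsetI)
  fix x assume x: "x \<in> centralizer (ratfun_elem r)"
  have "coeff_at x m = 0" if "m \<noteq> 0" for m
  proof (rule ccontr)
    assume "coeff_at x m \<noteq> 0"
    moreover have "r * coeff_at x m = coeff_at x m * sigma_pow m r"
      using x mem_centralizer_hom_elem_iff[of x r 0]
      by (simp add: ratfun_elem_def hom_elem_mem_centralizer_iff)
    ultimately have "sigma_pow m r = r" by simp
    then show False using sigma_pow_fixed_imp_const[OF that] assms by blast
  qed
  then have "x = ratfun_elem (coeff_at x 0)"
    by (intro skew_laurent_eqI) (auto simp: ratfun_elem_def coeff_at_hom_elem)
  then show "x \<in> range ratfun_elem" by blast
qed (auto simp: centralizer_def ratfun_elem_def hom_elem_mult mult.commute)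


section \<open>Recognizing Laurent polynomial subrings\<close>

lemma poly_mapping_eq_sum_single:
  "p = (\<Sum>i\<in>Poly_Mapping.keys p. Poly_Mapping.single i (Poly_Mapping.lookup p i))"
  by (rule poly_mapping_eqI)
    (simp add: lookup_sum lookup_single when_def in_keys_iff)

lemma subalgebra_gen_sum:
  "(\<And>i. i \<in> I \<Longrightarrow> f i \<in> subalgebra_gen S) \<Longrightarrow> sum f I \<in> subalgebra_gen S"
proof (induction I rule: infinite_finite_induct)
  case (insert i I)
  then show ?case by (simp add: subalgebra_gen.add)
qed (use subalgebra_gen.const[of 0 S] in \<open>simp_all add: const_elem_def ratfun_elem_def\<close>)

lemma subalgebra_gen_power: "x \<in> subalgebra_gen S \<Longrightarrow> x ^ k \<in> subalgebra_gen S"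
proof (induction k)
  case 0
  then show ?case using subalgebra_gen.const[of 1 S]
    by (simp add: const_elem_def ratfun_elem_def one_skew_laurent_def)
qed (simp add: subalgebra_gen.mult)

text \<open>Here \<open>b i\<close> is the coefficient of the intended power
  \<open>v\<^sup>i\<close>, of degree \<open>i * e\<close>. The cocycle identity
  \<open>b_add\<close> makes these elements multiply like powers, and \<open>A_iff\<close> says that
  the nonzero components of elements of \<open>A\<close> are constant multiples of them. The
  isomorphism sends \<open>t\<^sup>i\<close> to \<open>v i\<close>.\<close>

lemma laurent_ring_inI:
  fixes b :: "int \<Rightarrow> 'a::field_char_0 poly fract"
  assumes "e \<noteq> 0" "b 0 = 1" "\<And>i. b i \<noteq> 0"
    and b_add: "\<And>i j. b (i + j) = b i * sigma_pow (i * e) (b j)"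
    and A_iff: "\<And>x. x \<in> A \<longleftrightarrow> (\<forall>m. coeff_at x m \<noteq> 0 \<longrightarrow>
      (\<exists>i c. m = i * e \<and> coeff_at x m = ratfun_const c * b i))"
  shows "laurent_ring_in A (hom_elem (b 1) e)"
proof -
  define v where "v i = hom_elem (b i) (i * e)" for i
  have v_0: "v 0 = 1" using assms(2) by (simp add: v_def one_skew_laurent_def)
  have v_add: "v (i + j) = v i * v j" for i j
    by (simp add: v_def hom_elem_mult b_add distrib_right)
  have v_const: "v i * const_elem c = const_elem c * v i" for i c
    by (simp add: v_def const_elem_def ratfun_elem_def hom_elem_mult mult.commute)
  define \<phi> where "\<phi> p = (\<Sum>i\<in>Poly_Mapping.keys p. const_elem (Poly_Mapping.lookup p i) * v i)"
    for p :: "int \<Rightarrow>\<^sub>0 'a"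
  \<comment> \<open>Since \<open>e\<close> is nonzero, the degrees \<open>i * e\<close> are distinct
    and only \<open>i = m div e\<close> can contribute. Injectivity of \<phi> and the inclusion of
    its range in \<open>A\<close> are read off from this formula.\<close>
  have coeff_\<phi>: "coeff_at (\<phi> p) m =
      (if e dvd m then ratfun_const (Poly_Mapping.lookup p (m div e)) * b (m div e) else 0)" for p m
  proof -
    have "coeff_at (\<phi> p) m =
        (\<Sum>i\<in>Poly_Mapping.keys p. if m = i * e then ratfun_const (Poly_Mapping.lookup p i) * b i else 0)"
      by (auto simp: \<phi>_def coeff_at_sum v_def const_elem_mult_hom_elem coeff_at_hom_elem)
    also have "\<dots> = (\<Sum>i\<in>Poly_Mapping.keys p. if i = m div e then
        (if e dvd m then ratfun_const (Poly_Mapping.lookup p i) * b i else 0) else 0)"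
      using assms(1) by (intro sum.cong) auto
    also have "\<dots> = (if e dvd m then ratfun_const (Poly_Mapping.lookup p (m div e)) * b (m div e) else 0)"
      by (simp add: in_keys_iff)
    finally show ?thesis .
  qed
  have \<phi>_add: "\<phi> (p + q) = \<phi> p + \<phi> q" for p q
    by (rule skew_laurent_eqI) (simp add: coeff_\<phi> lookup_add ratfun_const_add distrib_right)
  have \<phi>_0: "\<phi> 0 = 0" by (simp add: \<phi>_def)
  have \<phi>_sum: "\<phi> (sum f I) = (\<Sum>i\<in>I. \<phi> (f i))" for f and I :: "int set"
    by (induction I rule: infinite_finite_induct) (simp_all add: \<phi>_0 \<phi>_add)
  have \<phi>_single: "\<phi> (Poly_Mapping.single i c) = const_elem c * v i" for i c
    by (cases "c = 0") (simp_all add: \<phi>_def const_elem_def ratfun_elem_def)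
  have const_mult: "const_elem (c * d) = const_elem c * (const_elem d :: 'a skew_laurent)" for c d
    by (simp add: const_elem_def ratfun_elem_def hom_elem_mult ratfun_const_mult)
  have \<phi>_mult_single: "\<phi> (Poly_Mapping.single i c * Poly_Mapping.single j d) =
      \<phi> (Poly_Mapping.single i c) * \<phi> (Poly_Mapping.single j d)" for i j c d
  proof -
    have "const_elem c * v i * (const_elem d * v j) = const_elem c * (v i * const_elem d) * v j"
      by (simp add: mult.assoc)
    then show ?thesis
      by (simp add: mult_single \<phi>_single v_const const_mult v_add mult.assoc)
  qed
  \<comment> \<open>By additivity it suffices to multiply monomials, where \<open>v_const\<close>
    moves scalars past the powers of the variable.\<close>
  have \<phi>_mult: "\<phi> (p * q) = \<phi> p * \<phi> q" for p q
  proof -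
    let ?m = "\<lambda>p i. Poly_Mapping.single i (Poly_Mapping.lookup p i) :: int \<Rightarrow>\<^sub>0 'a"
    have "\<phi> (sum (?m p) (Poly_Mapping.keys p) * sum (?m q) (Poly_Mapping.keys q)) =
        \<phi> (sum (?m p) (Poly_Mapping.keys p)) * \<phi> (sum (?m q) (Poly_Mapping.keys q))"
      by (simp only: sum_product \<phi>_sum \<phi>_mult_single)
    then show ?thesis by (simp only: poly_mapping_eq_sum_single[symmetric])
  qed
  have \<phi>_const: "\<phi> (Poly_Mapping.single 0 c) = const_elem c" for c
    by (simp add: \<phi>_single v_0)
  have \<phi>_v: "\<phi> (Poly_Mapping.single i 1) = v i" for i
    by (simp add: \<phi>_single v_def const_elem_mult_hom_elem)
  have inj: "inj \<phi>"
  proof (rule injI)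
    fix p q assume eq: "\<phi> p = \<phi> q"
    have "ratfun_const (Poly_Mapping.lookup p i) * b i = ratfun_const (Poly_Mapping.lookup q i) * b i" for i
      using arg_cong[OF eq, of "\<lambda>x. coeff_at x (i * e)"] assms(1) by (simp add: coeff_\<phi>)
    then show "p = q" using assms(3) by (intro poly_mapping_eqI) simp
  qed
  have range: "range \<phi> = A"
  proof (intro equalityI subsetI)
    fix x assume "x \<in> range \<phi>"
    then show "x \<in> A" unfolding A_iff by (auto simp: coeff_\<phi> elim!: dvdE) (metis mult.commute)
  next
    fix x assume x: "x \<in> A"
    have "hom_elem (coeff_at x m) m \<in> range \<phi>" for m
    proof (cases "coeff_at x m = 0")
      case True
      then show ?thesis using \<phi>_0 by (metis hom_elem_zero rangeI)
    next
      case False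
      then obtain i c where "m = i * e" "coeff_at x m = ratfun_const c * b i"
        using x A_iff by blast
      then have "hom_elem (coeff_at x m) m = \<phi> (Poly_Mapping.single i c)"
        by (simp add: \<phi>_single v_def const_elem_mult_hom_elem)
      then show ?thesis by blast
    qed
    \<comment> \<open>A preimage is chosen for each component; summing them over the finite support
      gives a preimage of \<open>x\<close>.\<close>
    then obtain P where "\<And>m. hom_elem (coeff_at x m) m = \<phi> (P m)"
      unfolding image_iff by metis
    then have "x = \<phi> (\<Sum>m\<in>support x. P m)"
      by (simp add: \<phi>_sum) (use skew_laurent_decomp[of "support x" x] in simp)
    then show "x \<in> range \<phi>" by blast
  qed
  have gen: "A = subalgebra_gen {v 1, v (- 1)}"
  proof (intro equalityI subsetI)
    fix x assume "x \<in> subalgebra_gen {v 1, v (- 1)}"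
    then have "x \<in> range \<phi>"
    proof induction
      case (incl x)
      then show ?case using \<phi>_v by (metis empty_iff insert_iff rangeI)
    next
      case (const c)
      then show ?case using \<phi>_const by (metis rangeI)
    next
      case (add x y)
      then show ?case by (auto simp flip: \<phi>_add)
    next
      case (mult x y)
      then show ?case by (auto simp flip: \<phi>_mult)
    qed
    then show "x \<in> A" by (simp add: range)
  next
    have v_nat: "v (int k * i) = v i ^ k" for k i
      by (induction k) (simp_all add: v_0 distrib_right v_add)
    have "v i \<in> subalgebra_gen {v 1, v (- 1)}" for i
    proof (cases "i \<ge> 0")
      case True
      then show ?thesis using v_nat[of "nat i" 1]
        by (simp add: subalgebra_gen_power subalgebra_gen.incl)
    next
      case False
      then show ?thesis using v_nat[of "nat (- i)" "- 1"]
        by (simp add: subalgebra_gen_power subalgebra_gen.incl)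
    qed
    then have "\<phi> p \<in> subalgebra_gen {v 1, v (- 1)}" for p
      unfolding \<phi>_def by (intro subalgebra_gen_sum subalgebra_gen.mult subalgebra_gen.const)
    moreover fix x assume "x \<in> A"
    ultimately show "x \<in> subalgebra_gen {v 1, v (- 1)}" using range by blast
  qed
  have v_1: "v 1 = hom_elem (b 1) e" by (simp add: v_def)
  have "v 1 * v (- 1) = 1" "v (- 1) * v 1 = 1"
    by (simp_all add: v_0 flip: v_add)
  moreover have "bij_betw \<phi> UNIV A"
    using inj range by (simp add: bij_betw_def)
  ultimately show ?thesis
    unfolding laurent_ring_in_def v_1[symmetric]
    using gen \<phi>_add \<phi>_mult \<phi>_const \<phi>_v[of 1] by blast
qed

lemma laurent_ring_in_mem:
  assumes "laurent_ring_in A v"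
  shows "v \<in> A"
proof -
  obtain w where "A = subalgebra_gen {v, w}"
    using assms unfolding laurent_ring_in_def by blast
  then show ?thesis by (simp add: subalgebra_gen.incl)
qed


section \<open>The centralizer of a monic homogeneous element\<close>

text \<open>Constants are central in B, so these are the degrees of all nonzero homogeneous elements
  of the centralizer.\<close>

definition monic_degrees :: "'a::field_char_0 skew_laurent \<Rightarrow> int set" where
  "monic_degrees u = {m. \<exists>\<gamma>. monic_ratfun \<gamma> \<and> hom_elem \<gamma> m \<in> centralizer u}"

lemma monic_degrees_0: "0 \<in> monic_degrees u"
proof -
  have "hom_elem 1 0 \<in> centralizer u"
    by (simp add: centralizer_def flip: one_skew_laurent_def)
  then show ?thesis unfolding monic_degrees_def using monic_ratfun_1 by blast
qed

lemma monic_degrees_add: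
  assumes "i \<in> monic_degrees u" "j \<in> monic_degrees u"
  shows "i + j \<in> monic_degrees u"
proof -
  obtain \<gamma> \<delta> where "monic_ratfun \<gamma>" "hom_elem \<gamma> i \<in> centralizer u"
    "monic_ratfun \<delta>" "hom_elem \<delta> j \<in> centralizer u"
    using assms unfolding monic_degrees_def by blast
  then have "monic_ratfun (\<gamma> * sigma_pow i \<delta>)" "hom_elem (\<gamma> * sigma_pow i \<delta>) (i + j) \<in> centralizer u"
    using centralizer_mult[of "hom_elem \<gamma> i" u "hom_elem \<delta> j"]
    by (simp_all add: monic_ratfun_mult monic_ratfun_sigma_pow hom_elem_mult)
  then show ?thesis unfolding monic_degrees_def by blast
qed

lemma monic_degrees_uminus:
  assumes "i \<in> monic_degrees u"
  shows "- i \<in> monic_degrees u"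
proof -
  obtain \<gamma> where \<gamma>: "monic_ratfun \<gamma>" "hom_elem \<gamma> i \<in> centralizer u"
    using assms unfolding monic_degrees_def by blast
  let ?\<delta> = "sigma_pow (- i) (inverse \<gamma>)"
  have "hom_elem \<gamma> i * hom_elem ?\<delta> (- i) = 1" "hom_elem ?\<delta> (- i) * hom_elem \<gamma> i = 1"
    using monic_ratfun_nonzero[OF \<gamma>(1)]
    by (simp_all add: hom_elem_mult one_skew_laurent_def sigma_pow_inverse sigma_pow_hom(4)[symmetric])
  then have "hom_elem ?\<delta> (- i) \<in> centralizer u" by (rule centralizer_inverse[OF \<gamma>(2)])
  moreover have "monic_ratfun ?\<delta>"
    using \<gamma>(1) by (intro monic_ratfun_sigma_pow monic_ratfun_inverse)
  ultimately show ?thesis unfolding monic_degrees_def by blast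
qed

text \<open>The generator is the least positive element: the remainder of any element modulo it lies
  in \<open>S\<close> again and is smaller, hence zero. The nonzero \<open>n\<close> excludes the
  trivial subgroup.\<close>

lemma int_subgroup_generator:
  fixes S :: "int set"
  assumes "0 \<in> S" "\<And>i j. i \<in> S \<Longrightarrow> j \<in> S \<Longrightarrow> i + j \<in> S" "\<And>i. i \<in> S \<Longrightarrow> - i \<in> S"
    and "n \<in> S" "n \<noteq> 0"
  obtains d :: nat where "d > 0" "\<And>m. m \<in> S \<longleftrightarrow> int d dvd m"
proof -
  define d where "d = (LEAST d. d > 0 \<and> int d \<in> S)"
  have "nat \<bar>n\<bar> > 0 \<and> int (nat \<bar>n\<bar>) \<in> S"
    using assms(4,5) assms(3)[OF assms(4)] by (cases "n > 0") simp_all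
  then have "d > 0 \<and> int d \<in> S"
    unfolding d_def by (rule LeastI)
  then have d: "d > 0" "int d \<in> S" by auto
  have least: "d \<le> k" if "k > 0" "int k \<in> S" for k
    unfolding d_def using that by (auto intro: Least_le)
  have nat_mult: "int k * int d \<in> S" for k
    by (induction k) (use assms(1,2) d in \<open>simp_all add: distrib_right\<close>)
  have mult: "i * int d \<in> S" for i
    using nat_mult[of "nat i"] assms(3)[OF nat_mult[of "nat (- i)"]] by (cases "i \<ge> 0") auto
  have "int d dvd m" if "m \<in> S" for m
  proof (rule ccontr)
    assume "\<not> int d dvd m"
    then have "m mod int d > 0" using d(1)
      by (metis dvd_eq_mod_eq_0 of_nat_0_less_iff pos_mod_sign order_le_less)
    moreover have "m mod int d \<in> S"
      using assms(2)[OF that mult[of "- (m div int d)"]] by (simp add: minus_div_mult_eq_mod)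
    ultimately have "int d \<le> m mod int d" using least[of "nat (m mod int d)"] by simp
    then show False using d(1) pos_mod_bound[of "int d" m] by linarith
  qed
  with mult d(1) show thesis by (intro that[of d]) (auto simp: dvd_def mult.commute)
qed

lemma dvd_sgn_mult_iff:
  fixes d n m :: int
  assumes "n \<noteq> 0"
  shows "sgn n * d dvd m \<longleftrightarrow> d dvd m" "m dvd sgn n * d \<longleftrightarrow> m dvd d"
  using assms by (simp_all add: sgn_if)

text \<open>Here \<open>s\<close> arises as the generator of the group of monic degrees; that it is
  the minimal divisor admitting a root is shown only afterwards.\<close>

lemma monic_centralizer_structure:
  assumes \<alpha>: "monic_ratfun \<alpha>" and n: "n \<noteq> 0"
  obtains s \<beta> where "minimal_root_divisor \<alpha> n s" "s > 0" "int s dvd n"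
    "twisted_root \<alpha> n s \<beta>" "monic_ratfun \<beta>"
    "laurent_ring_in (centralizer (hom_elem \<alpha> n)) (hom_elem \<beta> (sgn n * int s))"
proof -
  let ?u = "hom_elem \<alpha> n"
  let ?S = "monic_degrees ?u"
  have \<alpha>0: "\<alpha> \<noteq> 0" using \<alpha> by (rule monic_ratfun_nonzero)
  have u_mem: "?u \<in> centralizer ?u" by (simp add: centralizer_def)
  with \<alpha> have "n \<in> ?S" unfolding monic_degrees_def by blast
  then obtain s where s: "s > 0" and S_iff: "\<And>m. m \<in> ?S \<longleftrightarrow> int s dvd m"
    using int_subgroup_generator[OF monic_degrees_0 monic_degrees_add monic_degrees_uminus] n
    by metis
  \<comment> \<open>The sign makes the variable point in the direction of \<open>n\<close>, so that
    a nonnegative power of it reaches degree \<open>n\<close>; the multiples of \<open>e\<close> and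
    of \<open>s\<close> are the same.\<close>
  define e where "e = sgn n * int s"
  have e0: "e \<noteq> 0" using s n by (simp add: e_def sgn_0_0)
  have S_iff_e: "m \<in> ?S \<longleftrightarrow> e dvd m" for m
    using n by (simp add: e_def S_iff dvd_sgn_mult_iff)
  have s_dvd: "int s dvd n" using \<open>n \<in> ?S\<close> S_iff by blast
  have "\<exists>\<gamma>. monic_ratfun \<gamma> \<and> hom_elem \<gamma> (i * e) \<in> centralizer ?u" for i
    using S_iff_e[of "i * e"] by (simp add: monic_degrees_def)
  \<comment> \<open>Although \<open>b\<close> is chosen separately in each degree, uniqueness of
    monic elements forces the normalisation \<open>b 0 = 1\<close> and the cocycle identity
    \<open>b_add\<close>.\<close>
  then obtain b where b_monic: "\<And>i. monic_ratfun (b i)"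
    and b_mem: "\<And>i. hom_elem (b i) (i * e) \<in> centralizer ?u" by metis
  note unique = centralizer_monic_unique[OF \<alpha>0 n]
  have b0: "b 0 = 1"
    using b_monic[of 0] b_mem[of 0] monic_ratfun_1
    by (intro unique[of _ _ 0]) (simp_all add: hom_elem_mem_centralizer_iff sigma_pow_hom)
  have b_add: "b (i + j) = b i * sigma_pow (i * e) (b j)" for i j
  proof (rule unique)
    show "monic_ratfun (b i * sigma_pow (i * e) (b j))"
      by (intro monic_ratfun_mult monic_ratfun_sigma_pow b_monic)
    show "hom_elem (b i * sigma_pow (i * e) (b j)) ((i + j) * e) \<in> centralizer ?u"
      using centralizer_mult[OF b_mem[of i] b_mem[of j]] by (simp add: hom_elem_mult distrib_right)
  qed (fact b_monic b_mem)+
  have b_nz: "b i \<noteq> 0" for i using b_monic by (rule monic_ratfun_nonzero)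
  have centralizer_iff: "x \<in> centralizer ?u \<longleftrightarrow> (\<forall>m. coeff_at x m \<noteq> 0 \<longrightarrow>
      (\<exists>i c. m = i * e \<and> coeff_at x m = ratfun_const c * b i))" for x
  proof -
    have "hom_elem \<gamma> m \<in> centralizer ?u \<longleftrightarrow>
        (\<gamma> \<noteq> 0 \<longrightarrow> (\<exists>i c. m = i * e \<and> \<gamma> = ratfun_const c * b i))" (is "?L \<longleftrightarrow> ?R") for \<gamma> m
    proof (intro iffI impI)
      assume L: ?L and "\<gamma> \<noteq> 0"
      from \<open>\<gamma> \<noteq> 0\<close> obtain c \<delta>
        where c: "c \<noteq> 0" "monic_ratfun \<delta>" "\<gamma> = ratfun_const c * \<delta>"
        by (rule ratfun_eq_const_mult_monic)
      with L have "hom_elem \<delta> m \<in> centralizer ?u" by (simp add: centralizer_const_mult_iff)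
      with c have "m \<in> ?S" unfolding monic_degrees_def by blast
      then obtain i where i: "m = i * e" using S_iff_e by (auto simp: dvd_def mult.commute)
      have "\<delta> = b i"
        using unique[OF c(2) b_monic] \<open>hom_elem \<delta> m \<in> _\<close> b_mem i by blast
      with c i show "\<exists>i c. m = i * e \<and> \<gamma> = ratfun_const c * b i" by blast
    next
      assume R: ?R
      show ?L
      proof (cases "\<gamma> = 0")
        case False
        with R obtain i c where ic: "m = i * e" "\<gamma> = ratfun_const c * b i" by blast
        with False have "c \<noteq> 0" by auto
        then show ?thesis using b_mem[of i] by (simp add: ic centralizer_const_mult_iff)
      qed (simp add: centralizer_def)
    qed
    then show ?thesis by (subst mem_centralizer_hom_elem_iff) simp
  qed
  have laurent: "laurent_ring_in (centralizer ?u) (hom_elem (b 1) e)"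
    using e0 b0 b_nz b_add centralizer_iff by (rule laurent_ring_inI)
  have "hom_elem (b 1) e ^ k = hom_elem (b (int k)) (int k * e)" for k
  proof (induction k)
    case (Suc k)
    have "b (int (Suc k)) = b 1 * sigma_pow e (b (int k))" using b_add[of 1 "int k"] by simp
    with Suc show ?case by (simp add: hom_elem_mult distrib_right)
  qed (simp add: b0 one_skew_laurent_def)
  moreover have k: "int (nat \<bar>n\<bar> div s) * e = n"
    using s_dvd by (simp add: e_def zdiv_int mult.left_commute[of _ "sgn n"] sgn_mult_abs)
  \<comment> \<open>Both sides are monic coefficients of elements centralizing \<open>?u\<close> in
    degree \<open>n\<close>.\<close>
  moreover have "b (int (nat \<bar>n\<bar> div s)) = \<alpha>"
    using b_mem[of "int (nat \<bar>n\<bar> div s)"] u_mem unfolding k by (rule unique[OF b_monic \<alpha>])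
  ultimately have root: "twisted_root \<alpha> n s (b 1)"
    by (simp add: twisted_root_iff_power[OF n s_dvd] flip: e_def)
  \<comment> \<open>A root of order \<open>t\<close> commutes with its power \<open>?u\<close>.
    Scaled to be monic, it puts \<open>sgn n * int t\<close> into \<open>?S\<close>, so that
    \<open>s\<close> even divides \<open>t\<close>.\<close>
  have min: "s \<le> t" if "t > 0" "int t dvd n" "twisted_root \<alpha> n t \<gamma>" for t \<gamma>
  proof -
    let ?k = "nat \<bar>n\<bar> div t"
    have pow: "hom_elem \<gamma> (sgn n * int t) ^ ?k = ?u"
      using that n by (simp add: twisted_root_iff_power)
    have "int t \<le> \<bar>n\<bar>" using dvd_imp_le_int[OF n that(2)] by simp
    \<comment> \<open>With a positive exponent, \<gamma> = 0 would make the power vanish, while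
      \<open>?u\<close> is nonzero; a zeroth power would be 1 and allow no such conclusion.\<close>
    then have "?k > 0" using that(1) by (simp add: div_greater_zero_iff le_nat_iff)
    have "\<gamma> \<noteq> 0"
    proof
      assume "\<gamma> = 0"
      with \<open>?k > 0\<close> have "?u = 0" using pow by (simp add: power_0_left)
      then show False using \<alpha>0 hom_elem_eq_iff[of \<alpha> n 0] by simp
    qed
    then obtain c \<delta> where c: "c \<noteq> 0" "monic_ratfun \<delta>" "\<gamma> = ratfun_const c * \<delta>"
      by (rule ratfun_eq_const_mult_monic)
    have "hom_elem \<gamma> (sgn n * int t) \<in> centralizer ?u"
      unfolding pow[symmetric] by (simp add: centralizer_def power_commutes)
    with c have "hom_elem \<delta> (sgn n * int t) \<in> centralizer ?u"
      by (simp add: centralizer_const_mult_iff)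
    with c(2) have "sgn n * int t \<in> ?S" unfolding monic_degrees_def by blast
    then have "s dvd t" using n by (simp add: S_iff dvd_sgn_mult_iff)
    then show ?thesis using that(1) by (rule dvd_imp_le)
  qed
  have "minimal_root_divisor \<alpha> n s"
    unfolding minimal_root_divisor_def is_arg_min_linorder id_def using s s_dvd root min by blast
  with s s_dvd root b_monic laurent show thesis by (intro that[of s "b 1"]) (simp_all add: e_def)
qed

lemma twisted_root_mem_centralizer:
  assumes "n \<noteq> 0" "int s dvd n" "twisted_root \<alpha> n s \<gamma>"
  shows "hom_elem \<gamma> (sgn n * int s) \<in> centralizer (hom_elem \<alpha> n)"
proof -
  have pow: "hom_elem \<gamma> (sgn n * int s) ^ (nat \<bar>n\<bar> div s) = hom_elem \<alpha> n"
    using assms by (simp add: twisted_root_iff_power)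
  show ?thesis unfolding pow[symmetric] by (simp add: centralizer_def power_commutes)
qed

theorem proposition2p1:
  shows "(\<forall>(\<alpha> :: 'a::field_char_0 poly fract) (n :: int).
            monic_ratfun \<alpha> \<and> n \<noteq> 0 \<longrightarrow>
            (\<exists>s \<beta>.
               minimal_root_divisor \<alpha> n s \<and>
               twisted_root \<alpha> n s \<beta> \<and> monic_ratfun \<beta> \<and>
               (\<forall>\<gamma>. twisted_root \<alpha> n s \<gamma> \<and> monic_ratfun \<gamma> \<longrightarrow> \<gamma> = \<beta>) \<and>
               (\<forall>\<gamma>. twisted_root \<alpha> n s \<gamma> \<longrightarrow>
                     (\<exists>\<zeta>. \<zeta> ^ (nat \<bar>n\<bar> div s) = 1 \<and> \<gamma> = ratfun_const \<zeta> * \<beta>)) \<and>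
               laurent_ring_in (centralizer (hom_elem \<alpha> n)) (hom_elem \<beta> (sgn n * int s)) \<and>
               (\<forall>\<gamma>. monic_ratfun \<gamma> \<and>
                     laurent_ring_in (centralizer (hom_elem \<alpha> n)) (hom_elem \<gamma> (sgn n * int s)) \<longrightarrow>
                     \<gamma> = \<beta>)))
       \<and> (\<forall>r :: 'a poly fract. r \<notin> range ratfun_const \<longrightarrow>
            centralizer (ratfun_elem r) = range ratfun_elem)"
proof (intro conjI allI impI)
  fix \<alpha> :: "'a poly fract" and n :: int
  assume *: "monic_ratfun \<alpha> \<and> n \<noteq> 0"
  then have \<alpha>: "monic_ratfun \<alpha>" and n: "n \<noteq> 0" by auto
  obtain s \<beta> where s: "minimal_root_divisor \<alpha> n s" "s > 0" "int s dvd n"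
    and \<beta>: "twisted_root \<alpha> n s \<beta>" "monic_ratfun \<beta>"
    and laurent: "laurent_ring_in (centralizer (hom_elem \<alpha> n)) (hom_elem \<beta> (sgn n * int s))"
    by (rule monic_centralizer_structure[OF \<alpha> n])
  let ?e = "sgn n * int s"
  let ?C = "centralizer (hom_elem \<alpha> n)"
  have \<beta>_mem: "hom_elem \<beta> ?e \<in> ?C" using laurent by (rule laurent_ring_in_mem)
  \<comment> \<open>This serves both uniqueness claims: a root and a Laurent variable of degree
    \<open>?e\<close> both lie in the centralizer.\<close>
  have unique: "\<gamma> = \<beta>" if "monic_ratfun \<gamma>" "hom_elem \<gamma> ?e \<in> ?C" for \<gamma>
    using centralizer_monic_unique[OF monic_ratfun_nonzero[OF \<alpha>] n that(1) \<beta>(2) that(2) \<beta>_mem] .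
  have root_mem: "hom_elem \<gamma> ?e \<in> ?C" if "twisted_root \<alpha> n s \<gamma>" for \<gamma>
    using that by (rule twisted_root_mem_centralizer[OF n s(3)])
  \<comment> \<open>An arbitrary root is a constant multiple of \<beta>. Constants are fixed by
    \<sigma>, so the twisted product picks up the factor \<open>\<zeta> ^ ?k\<close>, which must be
    1 since both products equal \<alpha>.\<close>
  have roots: "\<exists>\<zeta>. \<zeta> ^ (nat \<bar>n\<bar> div s) = 1 \<and> \<gamma> = ratfun_const \<zeta> * \<beta>"
    if \<gamma>: "twisted_root \<alpha> n s \<gamma>" for \<gamma>
  proof -
    let ?k = "nat \<bar>n\<bar> div s"
    obtain \<zeta> where \<zeta>: "\<gamma> = ratfun_const \<zeta> * \<beta>"
      using centralizer_component_one_dim[OF monic_ratfun_nonzero[OF \<alpha>] n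
          monic_ratfun_nonzero[OF \<beta>(2)] root_mem[OF \<gamma>] \<beta>_mem] .
    have "hom_elem \<alpha> n = const_elem (\<zeta> ^ ?k) * hom_elem \<beta> ?e ^ ?k"
      using \<gamma> by (simp add: twisted_root_iff_power[OF n s(3)] \<zeta> hom_elem_const_mult_power)
    also have "\<dots> = hom_elem (ratfun_const (\<zeta> ^ ?k) * \<alpha>) n"
      using \<beta>(1) by (simp add: twisted_root_iff_power[OF n s(3)] const_elem_mult_hom_elem)
    finally have "\<alpha> = ratfun_const (\<zeta> ^ ?k) * \<alpha>" by (simp only: hom_elem_eq_iff)
    then have "ratfun_const (\<zeta> ^ ?k) = 1" using monic_ratfun_nonzero[OF \<alpha>] by simp
    then have "\<zeta> ^ ?k = 1" by (simp only: ratfun_const_eq_1_iff)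
    with \<zeta> show ?thesis by blast
  qed
  show "\<exists>s \<beta>.
     minimal_root_divisor \<alpha> n s \<and>
     twisted_root \<alpha> n s \<beta> \<and> monic_ratfun \<beta> \<and>
     (\<forall>\<gamma>. twisted_root \<alpha> n s \<gamma> \<and> monic_ratfun \<gamma> \<longrightarrow> \<gamma> = \<beta>) \<and>
     (\<forall>\<gamma>. twisted_root \<alpha> n s \<gamma> \<longrightarrow>
           (\<exists>\<zeta>. \<zeta> ^ (nat \<bar>n\<bar> div s) = 1 \<and> \<gamma> = ratfun_const \<zeta> * \<beta>)) \<and>
     laurent_ring_in (centralizer (hom_elem \<alpha> n)) (hom_elem \<beta> (sgn n * int s)) \<and>
     (\<forall>\<gamma>. monic_ratfun \<gamma> \<and>
           laurent_ring_in (centralizer (hom_elem \<alpha> n)) (hom_elem \<gamma> (sgn n * int s)) \<longrightarrow>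
           \<gamma> = \<beta>)"
    using s(1) \<beta> laurent roots unique root_mem laurent_ring_in_mem by blast
qed (fact centralizer_ratfun_elem)

end
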